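(* For every integer $n\ge 2$, the wheel graph $W_n$ satisfies $\alpha(W_n)\ge\tau(W_n)$, and hence $$\max\{T_{M(W_n)}(2,0),\,T_{M(W_n)}(0,2)\}\ \ge\ T_{M(W_n)}(1,1).$$
   Context: The wheel graph $W_n$ has $n+1$ vertices $0,1,\dots,n$ and $2n$ edges: the vertices $1,\dots,n$ form an $n$-cycle, and the vertex $0$ is adjacent to every vertex of this cycle (for $n=2$ the $2$-cycle is a pair of parallel edges). For a matroid $M=(E,r)$, $T_M(x,y)=\sum_{A\subseteq E}(x-1)^{r(E)-r(A)}(y-1)^{|A|-r(A)}$ is the Tutte polynomial; $M(G)$ is the cycle (graphic) matroid of a graph $G$. $\alpha(G)=T_{M(G)}(2,0)$ is the number of acyclic orientations of $G$ (orientations with no directed cycle), and for connected $G$, $\tau(G)=T_{M(G)}(1,1)$ is the number of spanning trees of $G$. *)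

theory Defs
  imports Main "HOL-Library.FuncSet"
begin

text \<open>
  The edges are abstract objects with a set of one (loop) or two end vertices, so that
  parallel edges are distinct.
\<close>

record ('v, 'e) multigraph =
  mg_verts :: "'v set"
  mg_edges :: "'e set"
  mg_ends :: "'e \<Rightarrow> 'v set"

text \<open>
  A cycle visits the distinct vertices \<open>vs\<close> and traverses the distinct edges \<open>es\<close>, the edge
  \<open>es ! i\<close> joining \<open>vs ! i\<close> to its cyclic successor. Length one is a loop, length two a pair of
  parallel edges.
\<close>

definition mg_cycle :: "('v, 'e) multigraph \<Rightarrow> 'v list \<Rightarrow> 'e list \<Rightarrow> bool" where
  "mg_cycle G vs es \<longleftrightarrow>
     es \<noteq> [] \<and> length vs = length es \<and> distinct vs \<and> distinct es \<and>
     set vs \<subseteq> mg_verts G \<and> set es \<subseteq> mg_edges G \<and>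
     (\<forall>i < length es. mg_ends G (es ! i) = {vs ! i, vs ! (Suc i mod length es)})"

definition mg_forest :: "('v, 'e) multigraph \<Rightarrow> 'e set \<Rightarrow> bool" where
  "mg_forest G A \<longleftrightarrow> A \<subseteq> mg_edges G \<and> \<not> (\<exists>vs es. mg_cycle G vs es \<and> set es \<subseteq> A)"

definition mg_adj :: "('v, 'e) multigraph \<Rightarrow> 'e set \<Rightarrow> ('v \<times> 'v) set" where
  "mg_adj G A = {(u, v). \<exists>e \<in> A. mg_ends G e = {u, v}}"

definition mg_connects :: "('v, 'e) multigraph \<Rightarrow> 'e set \<Rightarrow> bool" where
  "mg_connects G A \<longleftrightarrow> (\<forall>u \<in> mg_verts G. \<forall>v \<in> mg_verts G. (u, v) \<in> (mg_adj G A)\<^sup>*)"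

definition spanning_trees :: "('v, 'e) multigraph \<Rightarrow> 'e set set" where
  "spanning_trees G = {A. mg_forest G A \<and> mg_connects G A}"

definition num_spanning_trees :: "('v, 'e) multigraph \<Rightarrow> nat" where
  "num_spanning_trees G = card (spanning_trees G)"

text \<open>
  An orientation maps every edge to an ordered pair (tail, head) of its ends; it is extensional,
  hence counted once. Parallel edges are oriented independently.
\<close>

definition orientations :: "('v, 'e) multigraph \<Rightarrow> ('e \<Rightarrow> 'v \<times> 'v) set" where
  "orientations G = (\<Pi>\<^sub>E e \<in> mg_edges G. {(u, v). mg_ends G e = {u, v}})"

definition acyclic_orientations :: "('v, 'e) multigraph \<Rightarrow> ('e \<Rightarrow> 'v \<times> 'v) set" where
  "acyclic_orientations G = {ori \<in> orientations G. acyclic (ori ` mg_edges G)}"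

definition num_acyclic_orientations :: "('v, 'e) multigraph \<Rightarrow> nat" where
  "num_acyclic_orientations G = card (acyclic_orientations G)"

text \<open>
  A matroid is given by its ground set and rank function; the matroid axioms are not built into
  the type. The Tutte polynomial is rendered by its evaluations at points of a commutative ring.
  For the rank function of a matroid on a finite ground set the natural number subtractions in the
  exponents do not truncate, and \<open>0 ^ 0 = 1\<close> as usual.
\<close>

record 'e rank_matroid =
  mat_ground :: "'e set"
  mat_rank :: "'e set \<Rightarrow> nat"

definition tutte :: "'e rank_matroid \<Rightarrow> 'a::comm_ring_1 \<Rightarrow> 'a \<Rightarrow> 'a" where
  "tutte M x y =
     (\<Sum>A \<in> Pow (mat_ground M).
        (x - 1) ^ (mat_rank M (mat_ground M) - mat_rank M A) *
        (y - 1) ^ (card A - mat_rank M A))"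

text \<open>The independent sets are the forests, and the rank of a set is the size of a largest independent subset.\<close>

definition cycle_matroid :: "('v, 'e) multigraph \<Rightarrow> 'e rank_matroid" where
  "cycle_matroid G =
     \<lparr>mat_ground = mg_edges G,
      mat_rank = (\<lambda>A. Max (card ` {I. I \<subseteq> A \<and> mg_forest G I}))\<rparr>"

text \<open>
  \<open>Spoke i\<close> joins the hub \<open>0\<close> to \<open>i\<close>, and \<open>Rim i\<close> joins \<open>i\<close> to its successor on the cycle
  \<open>1, \<dots>, n\<close>. For \<open>n = 2\<close> the edges \<open>Rim 1\<close> and \<open>Rim 2\<close> are parallel.
\<close>

datatype wheel_edge = Spoke nat | Rim nat

definition wheel :: "nat \<Rightarrow> (nat, wheel_edge) multigraph" where
  "wheel n =
     \<lparr>mg_verts = {0..n},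
      mg_edges = Spoke ` {1..n} \<union> Rim ` {1..n},
      mg_ends = (\<lambda>e. case e of
          Spoke i \<Rightarrow> {0, i}
        | Rim i \<Rightarrow> {i, if i = n then 1 else Suc i})\<rparr>"

end

theory Submission
  imports Defs
begin

text \<open>
  Everything is compared with \<open>3 ^ n - 3\<close>. A spanning tree is determined by letting each rim vertex
  choose the first edge of a path to the hub; of these \<open>3 ^ n\<close> choices at least three (all clockwise,
  all counterclockwise, the vertices 1 and 2 choosing their common edge and all others their spokes)
  give no tree. The nonconstant words of length \<open>n\<close> over three letters inject into the acyclic
  orientations. Finally, \<open>T(2, 0)\<close> is the sum of \<open>(-1) ^ (card A - r A)\<close>: for a fixed set \<open>C\<close> of
  missing rim edges, the sum over the sets of spokes factorises over the arcs into which \<open>C\<close> cuts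
  the rim and equals \<open>2 ^ card C\<close>, except for \<open>C = {}\<close>, where it is \<open>- 2\<close>. Since \<open>T(1, 1)\<close> counts
  spanning trees, this yields both inequalities.
\<close>

subsection \<open>Connected components and the rank of the cycle matroid\<close>

definition mg_class :: "('v, 'e) multigraph \<Rightarrow> 'e set \<Rightarrow> 'v \<Rightarrow> 'v set" where
  "mg_class G A v = (mg_adj G A)\<^sup>* `` {v}"

definition mg_components :: "('v, 'e) multigraph \<Rightarrow> 'e set \<Rightarrow> nat" where
  "mg_components G A = card (mg_class G A ` mg_verts G)"

lemma sym_mg_adj: "sym (mg_adj G A)"
  by (auto simp: sym_def mg_adj_def insert_commute)

lemma mg_adj_rtrancl_sym: "(u, v) \<in> (mg_adj G A)\<^sup>* \<Longrightarrow> (v, u) \<in> (mg_adj G A)\<^sup>*"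
  by (meson sym_mg_adj sym_rtrancl symD)

lemma mg_adj_mono: "A \<subseteq> B \<Longrightarrow> mg_adj G A \<subseteq> mg_adj G B"
  by (auto simp: mg_adj_def)

lemma mg_class_eq_iff: "mg_class G A u = mg_class G A v \<longleftrightarrow> (u, v) \<in> (mg_adj G A)\<^sup>*"
proof
  assume "mg_class G A u = mg_class G A v"
  then have "v \<in> mg_class G A u" by (simp add: mg_class_def)
  then show "(u, v) \<in> (mg_adj G A)\<^sup>*" by (simp add: mg_class_def)
next
  assume "(u, v) \<in> (mg_adj G A)\<^sup>*"
  note uv = this mg_adj_rtrancl_sym[OF this]
  show "mg_class G A u = mg_class G A v"
    unfolding mg_class_def using uv by (auto dest: rtrancl_trans[OF uv(1)] rtrancl_trans[OF uv(2)])
qed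

lemma mem_mg_class: "y \<in> mg_class G A x \<longleftrightarrow> mg_class G A x = mg_class G A y"
  by (simp add: mg_class_eq_iff) (simp add: mg_class_def)

text \<open>A walk is split at its uses of the new edge by \<open>rtrancl_insert\<close>, once for
  each direction. Symmetry of adjacency then lets either end serve as the entry or the exit.\<close>

lemma mg_class_insert:
  assumes "mg_ends G e = {u, v}"
  shows "mg_class G (insert e A) x =
    (if mg_class G A x \<in> {mg_class G A u, mg_class G A v}
     then mg_class G A u \<union> mg_class G A v else mg_class G A x)"
proof -
  let ?R = "mg_adj G A"
  have "mg_adj G (insert e A) = insert (u, v) (insert (v, u) ?R)"
    using assms by (auto simp: mg_adj_def doubleton_eq_iff)
  then have "(x, y) \<in> (mg_adj G (insert e A))\<^sup>* \<longleftrightarrow> (x, y) \<in> ?R\<^sup>* \<or>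
     ((x, u) \<in> ?R\<^sup>* \<or> (x, v) \<in> ?R\<^sup>*) \<and> ((u, y) \<in> ?R\<^sup>* \<or> (v, y) \<in> ?R\<^sup>*)" for y
    using mg_adj_rtrancl_sym[of _ _ G A] by (auto simp: rtrancl_insert)
  then have new: "y \<in> mg_class G (insert e A) x \<longleftrightarrow> y \<in> mg_class G A x \<or>
     (u \<in> mg_class G A x \<or> v \<in> mg_class G A x) \<and> y \<in> mg_class G A u \<union> mg_class G A v" for y
    by (simp add: mg_class_def)
  show ?thesis
  proof (cases "mg_class G A x \<in> {mg_class G A u, mg_class G A v}")
    case True
    then have "u \<in> mg_class G A x \<or> v \<in> mg_class G A x" by (auto simp only: mem_mg_class)
    then show ?thesis using new True by auto
  next
    case False
    then have "\<not> (u \<in> mg_class G A x \<or> v \<in> mg_class G A x)" by (auto simp only: mem_mg_class)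
    then show ?thesis using new False by auto
  qed
qed

text \<open>Both functions have the same fibres on \<open>V\<close>, so passing from a value of
  \<open>f\<close> to a representative and on to its value under \<open>g\<close> is a bijection
  between the images.\<close>

lemma card_image_eq_card_image:
  assumes "\<And>x y. x \<in> V \<Longrightarrow> y \<in> V \<Longrightarrow> f x = f y \<longleftrightarrow> g x = g y"
  shows "card (f ` V) = card (g ` V)"
proof (rule bij_betw_same_card)
  have g: "g (inv_into V f (f x)) = g x" if "x \<in> V" for x
  proof -
    have "inv_into V f (f x) \<in> V" "f (inv_into V f (f x)) = f x"
      using that by (simp_all add: inv_into_into f_inv_into_f)
    then show ?thesis using assms that by blast
  qed
  then show "bij_betw (g \<circ> inv_into V f) (f ` V) (g ` V)"
    unfolding bij_betw_def inj_on_def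
    by (auto simp: image_image g assms)
qed

text \<open>A label reachable from its vertex and constant along edges is a canonical representative
  of the component. Components can thus be counted without computing the classes.\<close>

lemma mg_components_label:
  assumes "\<And>u. u \<in> mg_verts G \<Longrightarrow> (u, l u) \<in> (mg_adj G A)\<^sup>*"
    and "\<And>u v. (u, v) \<in> mg_adj G A \<Longrightarrow> l u = l v"
  shows "mg_components G A = card (l ` mg_verts G)"
  unfolding mg_components_def
proof (rule card_image_eq_card_image)
  fix u v assume uv: "u \<in> mg_verts G" "v \<in> mg_verts G"
  have "l u = l v" if "(u, v) \<in> (mg_adj G A)\<^sup>*"
    using that by induction (simp_all add: assms(2))
  moreover have "(u, v) \<in> (mg_adj G A)\<^sup>*" if "l u = l v"
    using rtrancl_trans[OF assms(1)[OF uv(1)]] mg_adj_rtrancl_sym[OF assms(1)[OF uv(2)]] that by simp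
  ultimately show "mg_class G A u = mg_class G A v \<longleftrightarrow> l u = l v"
    unfolding mg_class_eq_iff by blast
qed

lemma mg_connects_iff_components:
  assumes "finite (mg_verts G)" "mg_verts G \<noteq> {}"
  shows "mg_connects G A \<longleftrightarrow> mg_components G A = 1"
proof
  assume "mg_connects G A"
  moreover obtain a where a: "a \<in> mg_verts G" using assms by blast
  ultimately have "mg_class G A x = mg_class G A a" if "x \<in> mg_verts G" for x
    using that by (simp add: mg_connects_def mg_class_eq_iff)
  then have "mg_class G A ` mg_verts G = {mg_class G A a}" using a by blast
  then show "mg_components G A = 1" by (simp add: mg_components_def)
next
  assume "mg_components G A = 1"
  then obtain c where "mg_class G A ` mg_verts G = {c}"
    unfolding mg_components_def using card_1_singletonE by blast
  then have "mg_class G A x = c" if "x \<in> mg_verts G" for x using that by blast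
  then show "mg_connects G A"
    by (simp add: mg_connects_def flip: mg_class_eq_iff)
qed

section \<open>Simple paths, cycles and spanning forests\<close>

text \<open>The path is kept simple while it grows: if the next vertex already lies on it, the path
  is cut back to that vertex. Distinctness is what \<open>mg_cycle\<close> will require.\<close>

lemma rtrancl_simple_path:
  assumes "(u, v) \<in> R\<^sup>*"
  shows "\<exists>p. distinct p \<and> p \<noteq> [] \<and> hd p = u \<and> last p = v \<and>
    (\<forall>i. Suc i < length p \<longrightarrow> (p ! i, p ! Suc i) \<in> R)"
  using assms
proof induction
  case base
  show ?case by (intro exI[of _ "[u]"]) auto
next
  case (step y z)
  then obtain p where p: "distinct p" "p \<noteq> []" "hd p = u" "last p = y"
    and path: "\<And>i. Suc i < length p \<Longrightarrow> (p ! i, p ! Suc i) \<in> R" by blast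
  show ?case
  proof (cases "z \<in> set p")
    case True
    then obtain q r where qr: "p = q @ z # r" by (meson split_list)
    have "(q @ [z]) ! i = p ! i" if "i \<le> length q" for i
      using that by (simp add: qr nth_append)
    then have "((q @ [z]) ! i, (q @ [z]) ! Suc i) \<in> R" if "Suc i < length (q @ [z])" for i
      using path[of i] that by (simp add: qr)
    moreover have "hd (q @ [z]) = u" using p(3) qr by (cases q) auto
    moreover have "distinct (q @ [z])" using p(1) qr by simp
    ultimately show ?thesis by (intro exI[of _ "q @ [z]"] conjI) simp_all
  next
    case False
    have "((p @ [z]) ! i, (p @ [z]) ! Suc i) \<in> R" if "Suc i < length (p @ [z])" for i
    proof (cases "Suc i < length p")
      case True
      then show ?thesis using path by (simp add: nth_append)
    next
      case False
      then have "i = length p - 1" "Suc i = length p" using that by auto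
      then show ?thesis using p(2,4) step.hyps(2) by (simp add: nth_append last_conv_nth)
    qed
    moreover have "hd (p @ [z]) = u" "distinct (p @ [z])" using p False by simp_all
    ultimately show ?thesis by (intro exI[of _ "p @ [z]"] conjI allI impI) simp_all
  qed
qed

locale finite_multigraph =
  fixes G :: "('v, 'e) multigraph"
  assumes finite_verts: "finite (mg_verts G)"
    and finite_edges: "finite (mg_edges G)"
    and ends_in_verts: "e \<in> mg_edges G \<Longrightarrow> \<exists>u \<in> mg_verts G. \<exists>v \<in> mg_verts G. mg_ends G e = {u, v}"
begin

lemma mg_components_insert:
  assumes "mg_ends G e = {u, v}" "u \<in> mg_verts G" "v \<in> mg_verts G"
  shows "mg_components G A = mg_components G (insert e A) +
    (if (u, v) \<in> (mg_adj G A)\<^sup>* then 0 else 1)"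
proof -
  let ?K = "mg_class G A" and ?V = "mg_verts G"
  have new: "mg_class G (insert e A) ` ?V = insert (?K u \<union> ?K v) (?K ` ?V - {?K u, ?K v})"
    using assms(2,3) by (auto simp: mg_class_insert[OF assms(1)] image_iff)
  show ?thesis
  proof (cases "?K u = ?K v")
    case True
    then have "insert (?K u \<union> ?K v) (?K ` ?V - {?K u, ?K v}) = ?K ` ?V"
      using assms(2) by auto
    then show ?thesis using True new by (simp add: mg_components_def flip: mg_class_eq_iff)
  next
    case False
    \<comment> \<open>The union contains \<open>u\<close>, so a class equal to it would be the class
      of \<open>u\<close>, which has been removed. The merged class is therefore counted as a new
      one.\<close>
    have "?K u \<union> ?K v \<notin> ?K ` ?V - {?K u, ?K v}"
    proof
      assume "?K u \<union> ?K v \<in> ?K ` ?V - {?K u, ?K v}"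
      then obtain x where x: "?K u \<union> ?K v = ?K x" "?K x \<noteq> ?K u" by blast
      have "u \<in> ?K u" by (simp add: mem_mg_class)
      then have "u \<in> ?K x" using x(1) by blast
      then show False using x(2) by (simp add: mem_mg_class)
    qed
    moreover have "{?K u, ?K v} \<subseteq> ?K ` ?V" using assms by auto
    moreover have "card {?K u, ?K v} = 2" using False by simp
    moreover have "card {?K u, ?K v} \<le> card (?K ` ?V)"
      using finite_verts calculation(2) by (intro card_mono) auto
    ultimately show ?thesis
      using False finite_verts new
      by (simp add: mg_components_def mg_class_eq_iff card_Diff_subset)
  qed
qed

text \<open>Every \<open>A\<close>-class lies inside a single \<open>B\<close>-class, so the
  \<open>B\<close>-classes are the image of the \<open>A\<close>-classes under a map, and an image
  is no larger than its source.\<close>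

lemma mg_components_antimono:
  assumes "A \<subseteq> B"
  shows "mg_components G B \<le> mg_components G A"
proof -
  have "mg_class G B ` mg_verts G = (\<lambda>c. \<Union> (mg_class G B ` c)) ` mg_class G A ` mg_verts G"
    unfolding image_image
  proof (rule image_cong[OF refl])
    fix v
    have "mg_class G B x = mg_class G B v" if "x \<in> mg_class G A v" for x
      using that rtrancl_mono[OF mg_adj_mono[OF assms]]
      unfolding mem_mg_class mg_class_eq_iff by (blast intro: mg_adj_rtrancl_sym)
    moreover have "v \<in> mg_class G A v" by (simp add: mem_mg_class)
    ultimately show "mg_class G B v = \<Union> (mg_class G B ` mg_class G A v)" by blast
  qed
  then show ?thesis
    unfolding mg_components_def by (metis card_image_le finite_imageI finite_verts)
qed

lemma mg_components_empty: "mg_components G {} = card (mg_verts G)"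
  using mg_components_label[of G id "{}"] by (simp add: mg_adj_def)

lemma finite_sub_edges: "A \<subseteq> mg_edges G \<Longrightarrow> finite A"
  using finite_edges finite_subset by blast

text \<open>The count starts at the number of vertices, and each edge lowers it by at most
  one.\<close>

lemma mg_components_ge:
  assumes "A \<subseteq> mg_edges G"
  shows "card (mg_verts G) \<le> mg_components G A + card A"
  using finite_sub_edges[OF assms] assms
proof (induction rule: finite_induct)
  case empty
  then show ?case by (simp add: mg_components_empty)
next
  case (insert e A)
  obtain u v where "u \<in> mg_verts G" "v \<in> mg_verts G" "mg_ends G e = {u, v}"
    using ends_in_verts insert.prems by blast
  from mg_components_insert[OF this(3,1,2), of A] show ?case
    using insert by (auto split: if_splits)
qed

text \<open>A simple path in \<open>A\<close> between the ends of \<open>e\<close> would be closed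
  by \<open>e\<close> to a cycle. If \<open>e\<close> is a loop, the path is a single vertex and the
  cycle has length one.\<close>

lemma mg_forest_insert_not_connected:
  assumes forest: "mg_forest G (insert e A)" and "e \<notin> A" and ends: "mg_ends G e = {u, v}"
  shows "(u, v) \<notin> (mg_adj G A)\<^sup>*"
proof
  assume "(u, v) \<in> (mg_adj G A)\<^sup>*"
  from rtrancl_simple_path[OF this] obtain p where p: "distinct p" "p \<noteq> []" "hd p = u" "last p = v"
    and path: "\<And>i. Suc i < length p \<Longrightarrow> (p ! i, p ! Suc i) \<in> mg_adj G A" by blast
  define m where "m = length p - 1"
  have len: "length p = Suc m" using p(2) by (simp add: m_def)
  have "\<forall>i < m. \<exists>f \<in> A. mg_ends G f = {p ! i, p ! Suc i}"
    using path len by (auto simp: mg_adj_def)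
  then obtain g where g: "\<And>i. i < m \<Longrightarrow> g i \<in> A \<and> mg_ends G (g i) = {p ! i, p ! Suc i}" by metis
  \<comment> \<open>The edge \<open>e\<close> comes last because it leads from
    \<open>p ! m = v\<close> back to \<open>p ! 0 = u\<close>, as the wrap-around index in
    \<open>mg_cycle\<close> demands.\<close>
  define es where "es = map g [0..<m] @ [e]"
  have es_len: "length es = length p" by (simp add: es_def len)
  have sub: "set es \<subseteq> insert e A" using g by (auto simp: es_def)
  have edges: "insert e A \<subseteq> mg_edges G" using forest by (simp add: mg_forest_def)
  have "inj_on g {..<m}"
  proof (rule inj_onI)
    fix i j assume ij: "i \<in> {..<m}" "j \<in> {..<m}" "g i = g j"
    then have "{p ! i, p ! Suc i} = {p ! j, p ! Suc j}" using g by (metis lessThan_iff)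
    then show "i = j" using ij p(1) len
      by (auto simp: doubleton_eq_iff nth_eq_iff_index_eq)
  qed
  then have dist: "distinct es"
    using g \<open>e \<notin> A\<close> by (auto simp: es_def distinct_map atLeast0LessThan)
  have p0: "p ! 0 = u" and pm: "p ! m = v"
    using p by (auto simp: hd_conv_nth last_conv_nth m_def)
  have ends_es: "mg_ends G (es ! i) = {p ! i, p ! (Suc i mod length es)}" if "i < length es" for i
  proof (cases "i < m")
    case True
    then show ?thesis using g by (simp add: es_def nth_append)
  next
    case False
    then have "i = m" using that by (simp add: es_def)
    then show ?thesis using ends p0 pm by (auto simp: es_def nth_append)
  qed
  have "set p \<subseteq> mg_verts G"
  proof
    fix x assume "x \<in> set p"
    then obtain i where i: "i < length p" "x = p ! i" by (auto simp: in_set_conv_nth)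
    then have "es ! i \<in> set es" "x \<in> mg_ends G (es ! i)"
      using es_len ends_es[of i] by auto
    then have "es ! i \<in> mg_edges G" "x \<in> mg_ends G (es ! i)"
      using sub edges by auto
    then show "x \<in> mg_verts G" using ends_in_verts by fastforce
  qed
  then have "mg_cycle G p es"
    using p(1) dist ends_es es_len sub edges by (auto simp: mg_cycle_def es_def)
  then show False using forest sub by (auto simp: mg_forest_def)
qed

lemma mg_forest_subset: "mg_forest G A \<Longrightarrow> B \<subseteq> A \<Longrightarrow> mg_forest G B"
  by (meson mg_forest_def subset_trans)

lemma mg_forest_edges: "mg_forest G A \<Longrightarrow> A \<subseteq> mg_edges G"
  by (simp add: mg_forest_def)

text \<open>Each edge of a forest joins two different components of the edges added before it, so
  the count drops by exactly one every time.\<close>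

lemma mg_components_forest:
  assumes "mg_forest G A"
  shows "mg_components G A + card A = card (mg_verts G)"
proof -
  have "finite A" using assms by (intro finite_sub_edges mg_forest_edges)
  then show ?thesis using assms
  proof (induction rule: finite_induct)
    case empty
    then show ?case by (simp add: mg_components_empty)
  next
    case (insert e A)
    obtain u v where uv: "u \<in> mg_verts G" "v \<in> mg_verts G" "mg_ends G e = {u, v}"
      using ends_in_verts mg_forest_edges[OF insert.prems] by blast
    have "mg_forest G A" using insert.prems by (rule mg_forest_subset) blast
    then have "mg_components G A + card A = card (mg_verts G)" by (rule insert.IH)
    moreover have "mg_components G A = mg_components G (insert e A) + 1"
      using mg_components_insert[OF uv(3,1,2), of A]
        mg_forest_insert_not_connected[OF insert.prems insert.hyps(2) uv(3)] by simp
    ultimately show ?case using insert.hyps by simp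
  qed
qed

text \<open>The rest of the cycle is a detour around the deleted edge.\<close>

lemma mg_cycle_remove_edge:
  assumes cyc: "mg_cycle G vs es" and sub: "set es \<subseteq> A"
  shows "(mg_adj G A)\<^sup>* \<subseteq> (mg_adj G (A - {last es}))\<^sup>*"
proof -
  let ?R = "mg_adj G (A - {last es})"
  define m where "m = length es - 1"
  have ne: "es \<noteq> []" "distinct es" using cyc by (auto simp: mg_cycle_def)
  have len: "length es = Suc m" using ne by (simp add: m_def)
  have last: "last es = es ! m" using ne by (simp add: last_conv_nth m_def)
  have ends: "mg_ends G (es ! i) = {vs ! i, vs ! (Suc i mod length es)}" if "i < length es" for i
    using cyc that by (auto simp: mg_cycle_def)
  have step: "(vs ! i, vs ! Suc i) \<in> ?R" if "i < m" for i
  proof -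
    have "es ! i \<noteq> last es" using that ne(2) len by (auto simp: last nth_eq_iff_index_eq)
    then show ?thesis
      using ends[of i] that len sub by (auto simp: mg_adj_def intro!: bexI[of _ "es ! i"])
  qed
  have "i \<le> m \<Longrightarrow> (vs ! 0, vs ! i) \<in> ?R\<^sup>*" for i
    by (induction i) (auto intro: rtrancl_into_rtrancl[OF _ step])
  then have around: "(vs ! 0, vs ! m) \<in> ?R\<^sup>*" by simp
  have "mg_adj G A \<subseteq> ?R\<^sup>*"
  proof clarify
    fix a b assume "(a, b) \<in> mg_adj G A"
    then obtain f where f: "f \<in> A" "mg_ends G f = {a, b}" by (auto simp: mg_adj_def)
    show "(a, b) \<in> ?R\<^sup>*"
    proof (cases "f = last es")
      case True
      then have "{a, b} = {vs ! m, vs ! 0}" using f ends[of m] len last by simp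
      then show ?thesis using around mg_adj_rtrancl_sym by (auto simp: doubleton_eq_iff)
    next
      case False
      then have "(a, b) \<in> ?R" using f by (auto simp: mg_adj_def)
      then show ?thesis by blast
    qed
  qed
  then show ?thesis by (rule rtrancl_subset_rtrancl)
qed

text \<open>As long as a cycle remains, one of its edges can be deleted without changing
  reachability; finiteness makes this stop at a forest.\<close>

lemma spanning_forest_exists:
  assumes "A \<subseteq> mg_edges G"
  shows "\<exists>I \<subseteq> A. mg_forest G I \<and> mg_components G I = mg_components G A"
  using finite_sub_edges[OF assms] assms
proof (induction A rule: finite_psubset_induct)
  case (psubset A)
  show ?case
  proof (cases "mg_forest G A")
    case False
    then obtain vs es where c: "mg_cycle G vs es" "set es \<subseteq> A"
      using psubset.prems by (auto simp: mg_forest_def)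
    let ?B = "A - {last es}"
    have "last es \<in> A" using c by (auto simp: mg_cycle_def)
    then have "?B \<subset> A" by blast
    moreover have "mg_components G ?B = mg_components G A"
    proof -
      have "(mg_adj G A)\<^sup>* = (mg_adj G ?B)\<^sup>*"
        using mg_cycle_remove_edge[OF c] rtrancl_mono[OF mg_adj_mono[of ?B A G]] by blast
      then show ?thesis by (simp add: mg_components_def mg_class_def)
    qed
    moreover have "?B \<subseteq> mg_edges G" using psubset.prems by blast
    ultimately obtain I where "I \<subseteq> ?B" "mg_forest G I" "mg_components G I = mg_components G A"
      using psubset.IH[of ?B] by auto
    then show ?thesis by blast
  qed auto
qed

lemma finite_forest_cards: "A \<subseteq> mg_edges G \<Longrightarrow> finite (card ` {I. I \<subseteq> A \<and> mg_forest G I})"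
  by (rule finite_imageI) (simp add: finite_sub_edges)

section \<open>The rank function and spanning trees at (1, 1)\<close>

text \<open>A forest inside \<open>A\<close> has at least as many components as \<open>A\<close>,
  which bounds its size; a spanning forest of \<open>A\<close> attains the bound.\<close>

lemma cycle_matroid_rank:
  assumes A: "A \<subseteq> mg_edges G"
  shows "mat_rank (cycle_matroid G) A = card (mg_verts G) - mg_components G A"
proof -
  let ?S = "card ` {I. I \<subseteq> A \<and> mg_forest G I}"
  have "Max ?S = card (mg_verts G) - mg_components G A"
  proof (rule Max_eqI[OF finite_forest_cards[OF A]])
    fix y assume "y \<in> ?S"
    then obtain I where I: "I \<subseteq> A" "mg_forest G I" "y = card I" by blast
    then show "y \<le> card (mg_verts G) - mg_components G A"
      using mg_components_forest[OF I(2)] mg_components_antimono[OF I(1)] by simp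
  next
    obtain I where I: "I \<subseteq> A" "mg_forest G I" "mg_components G I = mg_components G A"
      using spanning_forest_exists[OF A] by blast
    then have "card (mg_verts G) - mg_components G A = card I"
      using mg_components_forest[OF I(2)] by simp
    then show "card (mg_verts G) - mg_components G A \<in> ?S" using I by blast
  qed
  then show ?thesis by (simp add: cycle_matroid_def)
qed

lemma cycle_matroid_rank_le_card:
  assumes "A \<subseteq> mg_edges G"
  shows "mat_rank (cycle_matroid G) A \<le> card A"
  using mg_components_ge[OF assms] by (simp add: cycle_matroid_rank[OF assms])

lemma mg_forest_if_full_rank:
  assumes A: "A \<subseteq> mg_edges G" and le: "card A \<le> mat_rank (cycle_matroid G) A"
  shows "mg_forest G A"
proof -
  obtain I where I: "I \<subseteq> A" "mg_forest G I" "mg_components G I = mg_components G A"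
    using spanning_forest_exists[OF A] by blast
  then have "card A \<le> card I"
    using mg_components_forest[OF I(2)] le by (simp add: cycle_matroid_rank[OF A])
  with I(1) have "I = A" by (rule card_seteq[OF finite_sub_edges[OF A]])
  then show ?thesis using I(2) by simp
qed

lemma card_spanning_tree:
  assumes "mg_verts G \<noteq> {}" "A \<in> spanning_trees G"
  shows "Suc (card A) = card (mg_verts G)"
  using assms mg_components_forest[of A] mg_connects_iff_components[OF finite_verts assms(1), of A]
  by (simp add: spanning_trees_def)

text \<open>At (1, 1) both bases are 0, so a summand is 1 exactly when both exponents vanish, which
  makes the set a spanning tree. One inequality suffices because the number of trees will be bounded
  from above.\<close>

lemma tutte_1_1_le_spanning_trees:
  assumes ne: "mg_verts G \<noteq> {}" and conn: "mg_connects G (mg_edges G)"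
  shows "(tutte (cycle_matroid G) 1 1 :: int) \<le> int (num_spanning_trees G)"
proof -
  let ?r = "mat_rank (cycle_matroid G)" and ?E = "mg_edges G"
  have comp: "mg_components G ?E = 1" using mg_connects_iff_components[OF finite_verts ne] conn by simp
  have V: "card (mg_verts G) \<ge> 1" using ne finite_verts by (simp add: Suc_le_eq card_gt_0_iff)
  have term_le: "(0::int) ^ (?r ?E - ?r A) * 0 ^ (card A - ?r A) \<le> (if A \<in> spanning_trees G then 1 else 0)"
    if A: "A \<subseteq> ?E" for A
  proof (cases "?r ?E \<le> ?r A \<and> card A \<le> ?r A")
    case True
    then have "mg_forest G A" using mg_forest_if_full_rank[OF A] by blast
    moreover have "mg_components G A = 1"
    proof -
      have "mg_components G A \<ge> 1" using mg_components_antimono[OF A] comp by simp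
      \<comment> \<open>This excludes truncation in the comparison below, which for a single vertex
        would otherwise say nothing.\<close>
      moreover have "mg_components G A \<le> card (mg_verts G)"
        using mg_components_antimono[of "{}" A] by (simp add: mg_components_empty)
      moreover have "card (mg_verts G) - 1 \<le> card (mg_verts G) - mg_components G A"
        using True comp by (simp add: cycle_matroid_rank[OF A] cycle_matroid_rank[OF order_refl])
      ultimately show ?thesis using V by linarith
    qed
    ultimately have "A \<in> spanning_trees G"
      using mg_connects_iff_components[OF finite_verts ne] by (simp add: spanning_trees_def)
    then show ?thesis using True by simp
  qed (auto simp: power_0_left)
  have "(tutte (cycle_matroid G) 1 1 :: int) =
      (\<Sum>A \<in> Pow ?E. 0 ^ (?r ?E - ?r A) * 0 ^ (card A - ?r A))"
    by (simp add: tutte_def) (simp add: cycle_matroid_def)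
  also have "\<dots> \<le> (\<Sum>A \<in> Pow ?E. if A \<in> spanning_trees G then 1 else 0)"
    using term_le by (intro sum_mono) auto
  also have "\<dots> = int (card (spanning_trees G))"
  proof -
    have "Pow ?E \<inter> {A. A \<in> spanning_trees G} = spanning_trees G"
      by (auto simp: spanning_trees_def mg_forest_def)
    then show ?thesis using finite_edges by (simp add: sum.If_cases)
  qed
  finally show ?thesis by (simp add: num_spanning_trees_def)
qed

end

subsection \<open>The wheel and its acyclic orientations\<close>

definition wheel_succ :: "nat \<Rightarrow> nat \<Rightarrow> nat" where
  "wheel_succ n i = (if i = n then 1 else Suc i)"

definition wheel_pred :: "nat \<Rightarrow> nat \<Rightarrow> nat" where
  "wheel_pred n i = (if i = 1 then n else i - 1)"

lemma wheel_succ_in: "i \<in> {1..n} \<Longrightarrow> wheel_succ n i \<in> {1..n}"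
  by (auto simp: wheel_succ_def)

lemma wheel_pred_in: "i \<in> {1..n} \<Longrightarrow> wheel_pred n i \<in> {1..n}"
  by (auto simp: wheel_pred_def)

lemma wheel_succ_pred: "i \<in> {1..n} \<Longrightarrow> wheel_succ n (wheel_pred n i) = i"
  by (auto simp: wheel_succ_def wheel_pred_def)

lemma wheel_pred_succ: "i \<in> {1..n} \<Longrightarrow> wheel_pred n (wheel_succ n i) = i"
  by (auto simp: wheel_succ_def wheel_pred_def)

lemma wheel_succ_neq: "n \<ge> 2 \<Longrightarrow> wheel_succ n i \<noteq> i"
  by (auto simp: wheel_succ_def)

text \<open>Induction around the rim: from \<open>i\<close> up to \<open>n\<close>, across to 1, and
  up again to \<open>j\<close>.\<close>

lemma wheel_succ_closed:
  assumes "i \<in> {1..n}" "P i" and closed: "\<And>j. j \<in> {1..n} \<Longrightarrow> P j \<Longrightarrow> P (wheel_succ n j)"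
    and j: "j \<in> {1..n}"
  shows "P j"
proof -
  have up: "P l" if "k \<in> {1..n}" "P k" "k \<le> l" "l \<le> n" for k l
    using that(3,4)
  proof (induction rule: dec_induct)
    case (step m)
    then show ?case using closed[of m] that(1) by (simp add: wheel_succ_def split: if_splits)
  qed (rule that(2))
  have "P n" using up[OF assms(1,2)] assms(1) by simp
  then have "P 1" using closed[of n] assms(1) by (simp add: wheel_succ_def)
  then show ?thesis using up[of 1 j] j by simp
qed

lemma wheel_succ_reaches:
  assumes "i \<in> {1..n}" "j \<in> {1..n}"
  shows "\<exists>k. (wheel_succ n ^^ k) i = j"
  using assms(1) _ _ assms(2)
proof (rule wheel_succ_closed)
  show "\<exists>k. (wheel_succ n ^^ k) i = i" by (rule exI[of _ 0]) simp
  show "\<exists>k. (wheel_succ n ^^ k) i = wheel_succ n j" if "\<exists>k. (wheel_succ n ^^ k) i = j" for j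
    using that by (metis comp_apply funpow.simps(2))
qed

text \<open>The first element of \<open>J\<close> met when walking forward from \<open>i\<close>,
  with \<open>i\<close> itself included. It serves both to copy spoke directions and to name the arc
  of the rim that contains \<open>i\<close>.\<close>

definition next_in :: "nat \<Rightarrow> nat set \<Rightarrow> nat \<Rightarrow> nat" where
  "next_in n J i = (wheel_succ n ^^ (LEAST k. (wheel_succ n ^^ k) i \<in> J)) i"

lemma next_in_self: "i \<in> J \<Longrightarrow> next_in n J i = i"
  by (simp add: next_in_def)

lemma next_in_succ:
  assumes "J \<subseteq> {1..n}" "J \<noteq> {}" "i \<in> {1..n}" "i \<notin> J"
  shows "next_in n J i = next_in n J (wheel_succ n i)"
proof -
  obtain j where "j \<in> J" using assms(2) by blast
  then obtain k where "(wheel_succ n ^^ k) i \<in> J"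
    using wheel_succ_reaches[OF assms(3)] assms(1) by blast
  then have "(LEAST k. (wheel_succ n ^^ k) i \<in> J) = Suc (LEAST k. (wheel_succ n ^^ Suc k) i \<in> J)"
    by (rule Least_Suc) (simp add: assms(4))
  then show ?thesis by (simp add: next_in_def funpow_Suc_right del: funpow.simps)
qed

lemma next_in_mem:
  assumes "J \<subseteq> {1..n}" "J \<noteq> {}" "i \<in> {1..n}"
  shows "next_in n J i \<in> J"
proof -
  obtain j where "j \<in> J" using assms(2) by blast
  then obtain k where "(wheel_succ n ^^ k) i \<in> J"
    using wheel_succ_reaches[OF assms(3)] assms(1) by blast
  then show ?thesis unfolding next_in_def by (rule LeastI)
qed

lemma wheel_simps [simp]:
  "mg_verts (wheel n) = {0..n}"
  "mg_edges (wheel n) = Spoke ` {1..n} \<union> Rim ` {1..n}"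
  "mg_ends (wheel n) (Spoke i) = {0, i}"
  "mg_ends (wheel n) (Rim i) = {i, wheel_succ n i}"
  by (simp_all add: wheel_def wheel_succ_def)

lemma finite_multigraph_wheel: "finite_multigraph (wheel n)"
proof
  fix e assume "e \<in> mg_edges (wheel n)"
  then show "\<exists>u \<in> mg_verts (wheel n). \<exists>v \<in> mg_verts (wheel n). mg_ends (wheel n) e = {u, v}"
    using wheel_succ_in[of _ n] by fastforce
qed auto

text \<open>
  If every element of \<open>Q\<close> had a predecessor in \<open>Q\<close>, then following predecessors would run around
  the whole rim against the direction of its edges, so that they would all point the same way.
\<close>

lemma cycle_orientation_has_source:
  assumes n: "n \<ge> 2"
    and fwd: "i \<in> {1..n}" "f i" and bwd: "j \<in> {1..n}" "\<not> f j"
    and Q: "Q \<subseteq> {1..n}" "Q \<noteq> {}"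
  shows "\<exists>q \<in> Q. (f q \<or> wheel_succ n q \<notin> Q) \<and> \<not> (f (wheel_pred n q) \<and> wheel_pred n q \<in> Q)"
proof (rule ccontr)
  assume "\<not> ?thesis"
  then have pred: "(\<not> f q \<and> wheel_succ n q \<in> Q) \<or> (f (wheel_pred n q) \<and> wheel_pred n q \<in> Q)"
    if "q \<in> Q" for q using that by blast
  \<comment> \<open>\<open>P k\<close> says that the rim edge at \<open>k\<close> points forward
    with both ends in \<open>Q\<close>. If it holds at the successor of \<open>k\<close>, it holds
    at \<open>k\<close>; hence the backward edge at \<open>j\<close> excludes it everywhere.\<close>
  define P where "P k \<longleftrightarrow> f k \<and> k \<in> Q \<and> wheel_succ n k \<in> Q" for k
  have "\<not> P k" if k: "k \<in> {1..n}" for k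
  proof (rule wheel_succ_closed[of j n "\<lambda>k. \<not> P k"])
    show "\<not> P (wheel_succ n k)" if "k \<in> {1..n}" "\<not> P k" for k
      using that pred[of "wheel_succ n k"] wheel_pred_succ[of k n] by (auto simp: P_def)
  qed (use bwd k in \<open>auto simp: P_def\<close>)
  then have noP: "\<not> (f (wheel_pred n q) \<and> wheel_pred n q \<in> Q)" if "q \<in> Q" for q
  proof -
    have "q \<in> {1..n}" using that Q(1) by blast
    then have "\<not> P (wheel_pred n q)" "wheel_succ n (wheel_pred n q) = q"
      using \<open>\<And>k. k \<in> {1..n} \<Longrightarrow> \<not> P k\<close> wheel_pred_in wheel_succ_pred by blast+
    then show ?thesis using that by (simp add: P_def)
  qed
  obtain q where q: "q \<in> Q" using Q(2) by blast
  \<comment> \<open>Only backward edges with the next vertex in \<open>Q\<close> are left as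
    predecessors, so membership in \<open>Q\<close> spreads forward to \<open>i\<close>, where the
    edge is not backward.\<close>
  have "i \<in> Q \<and> \<not> f i"
  proof (rule wheel_succ_closed[of q n "\<lambda>k. k \<in> Q \<and> \<not> f k"])
    show "q \<in> {1..n}" using q Q(1) by blast
    show "q \<in> Q \<and> \<not> f q" using q pred noP by blast
    show "wheel_succ n k \<in> Q \<and> \<not> f (wheel_succ n k)" if "k \<in> Q \<and> \<not> f k" for k
      using that pred noP by blast
  qed (rule fwd(1))
  then show False using fwd(2) by blast
qed

section \<open>Acyclic orientations from spoke and rim directions\<close>

definition wheel_orientation :: "nat \<Rightarrow> (nat \<Rightarrow> bool) \<Rightarrow> (nat \<Rightarrow> bool) \<Rightarrow> wheel_edge \<Rightarrow> nat \<times> nat" where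
  "wheel_orientation n s f = restrict (\<lambda>e. case e of
      Spoke i \<Rightarrow> if s i then (i, 0) else (0, i)
    | Rim i \<Rightarrow> if f i then (i, wheel_succ n i) else (wheel_succ n i, i)) (mg_edges (wheel n))"

lemma wheel_orientation_Spoke:
  "i \<in> {1..n} \<Longrightarrow> wheel_orientation n s f (Spoke i) = (if s i then (i, 0) else (0, i))"
  by (simp add: wheel_orientation_def)

lemma wheel_orientation_Rim:
  "i \<in> {1..n} \<Longrightarrow> wheel_orientation n s f (Rim i) =
    (if f i then (i, wheel_succ n i) else (wheel_succ n i, i))"
  by (simp add: wheel_orientation_def)

text \<open>Vertices with inward spokes lie above the hub and the others below it, and by
  \<open>forced\<close> no rim edge climbs. A directed cycle would have to run along the whole rim,
  which edges of both directions prevent. Formally, every nonempty set of numbers is shown to have a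
  source.\<close>

lemma wheel_orientation_acyclic:
  assumes n: "n \<ge> 2"
    and fwd: "i \<in> {1..n}" "f i" and bwd: "j \<in> {1..n}" "\<not> f j"
    and forced: "\<And>k. k \<in> {1..n} \<Longrightarrow> s k \<noteq> s (wheel_succ n k) \<Longrightarrow> f k = s k"
  shows "wheel_orientation n s f \<in> acyclic_orientations (wheel n)"
proof -
  let ?o = "wheel_orientation n s f" and ?E = "mg_edges (wheel n)"
  have "?o \<in> orientations (wheel n)"
    by (auto simp: orientations_def wheel_orientation_def PiE_iff split: if_splits)
  moreover have "acyclic (?o ` ?E)"
  proof (rule wf_acyclic, unfold wf_eq_minimal, intro allI impI)
    have edge: "(b = 0 \<and> a \<in> {1..n} \<and> s a) \<or> (a = 0 \<and> b \<in> {1..n} \<and> \<not> s b) \<or>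
      (a \<in> {1..n} \<and> b \<in> {1..n} \<and> (s b \<longrightarrow> s a) \<and>
        ((f a \<and> b = wheel_succ n a) \<or> (\<not> f b \<and> a = wheel_succ n b)))"
      if "(a, b) \<in> ?o ` ?E" for a b
      using that
    proof
      fix e assume e: "(a, b) = ?o e" "e \<in> ?E"
      show ?thesis
      proof (cases e)
        case (Spoke k)
        then show ?thesis using e by (auto simp: wheel_orientation_Spoke split: if_splits)
      next
        case (Rim k)
        then have "k \<in> {1..n}" using e by auto
        then show ?thesis using e Rim forced[of k] wheel_succ_in[of k n]
          by (auto simp: wheel_orientation_Rim split: if_splits)
      qed
    qed
    fix Q :: "nat set" and x assume "x \<in> Q"
    show "\<exists>z \<in> Q. \<forall>y. (y, z) \<in> ?o ` ?E \<longrightarrow> y \<notin> Q"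
    proof -
      \<comment> \<open>\<open>U\<close> is the highest layer of \<open>Q\<close> on the rim: the
        vertices with inward spokes if there are any, otherwise all rim vertices of
        \<open>Q\<close>. If no spoke in \<open>Q\<close> points inward and the hub lies in
        \<open>Q\<close>, the hub itself is the source.\<close>
      define U where "U = (if {k \<in> Q \<inter> {1..n}. s k} \<noteq> {} then {k \<in> Q \<inter> {1..n}. s k}
        else Q \<inter> {1..n})"
      have source: "\<exists>z \<in> U. \<forall>y \<in> U. (y, z) \<notin> ?o ` ?E" if "U \<noteq> {}"
      proof -
        have "U \<subseteq> {1..n}" by (auto simp: U_def)
        from cycle_orientation_has_source[OF n fwd bwd this that]
        obtain q where q: "q \<in> U" "f q \<or> wheel_succ n q \<notin> U"
          "\<not> (f (wheel_pred n q) \<and> wheel_pred n q \<in> U)" by blast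
        have "(y, q) \<notin> ?o ` ?E" if "y \<in> U" for y
        proof
          assume "(y, q) \<in> ?o ` ?E"
          moreover have "y \<in> {1..n}" "q \<in> {1..n}" using that q(1) \<open>U \<subseteq> {1..n}\<close> by blast+
          ultimately have "(f y \<and> q = wheel_succ n y) \<or> (\<not> f q \<and> y = wheel_succ n q)"
            using edge[of y q] by auto
          then show False
            using q that wheel_pred_succ[OF \<open>y \<in> {1..n}\<close>] by auto
        qed
        then show ?thesis using q(1) by blast
      qed
      consider (upper) "{k \<in> Q \<inter> {1..n}. s k} \<noteq> {}"
        | (hub) "{k \<in> Q \<inter> {1..n}. s k} = {}" "0 \<in> Q"
        | (lower) "{k \<in> Q \<inter> {1..n}. s k} = {}" "0 \<notin> Q" by blast
      then show ?thesis
      proof cases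
        case upper
        then have U: "U = {k \<in> Q \<inter> {1..n}. s k}" by (simp add: U_def)
        then obtain z where z: "z \<in> U" "\<forall>y \<in> U. (y, z) \<notin> ?o ` ?E" using source upper by auto
        have "y \<in> U" if "(y, z) \<in> ?o ` ?E" "y \<in> Q" for y
          using edge[OF that(1)] that(2) z(1) by (auto simp: U)
        then show ?thesis using z U by blast
      next
        case hub
        then have "y \<notin> Q" if "(y, 0) \<in> ?o ` ?E" for y
          using edge[OF that] by auto
        then show ?thesis using hub by blast
      next
        case lower
        then have U: "U = Q \<inter> {1..n}" by (simp add: U_def)
        show ?thesis
        proof (cases "U = {}")
          \<comment> \<open>Here \<open>x\<close> exceeds \<open>n\<close> and is no vertex of the
            wheel, so no arc ends at it.\<close>
          case True
          then have "(y, x) \<notin> ?o ` ?E" for y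
            using edge[of y x] \<open>x \<in> Q\<close> lower(2) U by auto
          then show ?thesis using \<open>x \<in> Q\<close> by blast
        next
          case False
          then obtain z where z: "z \<in> U" "\<forall>y \<in> U. (y, z) \<notin> ?o ` ?E" using source by auto
          have "y \<in> U" if "(y, z) \<in> ?o ` ?E" "y \<in> Q" for y
            using edge[OF that(1)] that(2) z(1) lower(2) by (auto simp: U)
          then show ?thesis using z U by blast
        qed
      qed
    qed
  qed
  ultimately show ?thesis by (simp add: acyclic_orientations_def)
qed

text \<open>For \<open>n \<ge> 2\<close> no edge is a loop, so the two directions of an edge are
  different pairs.\<close>

lemma wheel_orientation_inject:
  assumes n: "n \<ge> 2" and eq: "wheel_orientation n s f = wheel_orientation n t g" and i: "i \<in> {1..n}"
  shows "s i = t i \<and> f i = g i"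
proof -
  have "wheel_orientation n s f (Spoke i) = wheel_orientation n t g (Spoke i)"
    "wheel_orientation n s f (Rim i) = wheel_orientation n t g (Rim i)" using eq by simp_all
  then show ?thesis
    using i wheel_succ_neq[OF n, of i]
    by (auto simp: wheel_orientation_Spoke wheel_orientation_Rim split: if_splits)
qed

text \<open>
  Letters \<open>Some True\<close>, \<open>Some False\<close> prescribe the spoke at a vertex to point towards or away from
  the hub; vertices labelled \<open>None\<close> copy the direction of the next vertex. A rim edge between
  spokes of different direction is forced, and otherwise the two directions are told apart by
  whether its first vertex is labelled \<open>None\<close>.
\<close>

definition spoke_inward :: "nat \<Rightarrow> (nat \<Rightarrow> bool option) \<Rightarrow> nat \<Rightarrow> bool" where
  "spoke_inward n w i = the (w (next_in n {j \<in> {1..n}. w j \<noteq> None} i))"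

definition rim_forward :: "nat \<Rightarrow> (nat \<Rightarrow> bool option) \<Rightarrow> nat \<Rightarrow> bool" where
  "rim_forward n w i = (if spoke_inward n w i = spoke_inward n w (wheel_succ n i) then w i = None
     else spoke_inward n w i)"

lemma spoke_inward_Some:
  assumes "i \<in> {1..n}" "w i \<noteq> None"
  shows "w i = Some (spoke_inward n w i)"
  using assms by (simp add: spoke_inward_def next_in_self)

lemma spoke_inward_None:
  assumes "i \<in> {1..n}" "w i = None" "j \<in> {1..n}" "w j \<noteq> None"
  shows "spoke_inward n w i = spoke_inward n w (wheel_succ n i)"
proof -
  have "next_in n {j \<in> {1..n}. w j \<noteq> None} i = next_in n {j \<in> {1..n}. w j \<noteq> None} (wheel_succ n i)"
    using assms by (intro next_in_succ) auto
  then show ?thesis by (simp only: spoke_inward_def)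
qed

text \<open>The three constant words are left out because they would make the rim a directed cycle:
  all spokes agree, and the rim edges all point forward for \<open>None\<close> and all backward for
  the other letters.\<close>

lemma num_acyclic_orientations_wheel_ge:
  assumes n: "n \<ge> 2"
  shows "3 ^ n - 3 \<le> num_acyclic_orientations (wheel n)"
proof -
  define L :: "bool option set" where "L = {None, Some True, Some False}"
  define bad :: "(nat \<Rightarrow> bool option) set" where "bad = (\<lambda>l. restrict (\<lambda>_. l) {1..n}) ` L"
  define W where "W = (\<Pi>\<^sub>E i \<in> {1..n}. L) - bad"
  define \<Phi> where "\<Phi> w = wheel_orientation n (spoke_inward n w) (rim_forward n w)" for w
  have L_UNIV: "l \<in> L" for l by (cases l) (auto simp: L_def)
  have const_bad: "w \<in> bad" if "w \<in> (\<Pi>\<^sub>E i \<in> {1..n}. L)" "\<And>i. i \<in> {1..n} \<Longrightarrow> w i = l" for w l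
  proof -
    have "w = restrict (\<lambda>_. l) {1..n}" by (rule PiE_ext[OF that(1)]) (auto simp: that(2) L_UNIV)
    then show ?thesis by (auto simp: bad_def L_UNIV)
  qed
  have ex: "\<exists>j \<in> {1..n}. w j \<noteq> None" if "w \<in> W" for w
    using that const_bad[of w None] unfolding W_def by blast
  have "\<Phi> w \<in> acyclic_orientations (wheel n)" if w: "w \<in> W" for w
  proof -
    let ?s = "spoke_inward n w" and ?f = "rim_forward n w"
    obtain j where j: "j \<in> {1..n}" "w j \<noteq> None" using ex[OF w] by blast
    \<comment> \<open>A forward edge at a vertex labelled \<open>Some\<close> leads from an inward
      to an outward spoke. If all edges were forward, outwardness would spread around the rim and
      return to \<open>j\<close>.\<close>
    have "\<exists>i \<in> {1..n}. \<not> ?f i"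
    proof (rule ccontr)
      assume "\<not> ?thesis"
      then have f: "?f i" if "i \<in> {1..n}" for i using that by blast
      have "?s j \<and> \<not> ?s (wheel_succ n j)"
        using f[OF j(1)] j(2) by (auto simp: rim_forward_def split: if_splits)
      moreover have "\<not> ?s j"
      proof (rule wheel_succ_closed[of "wheel_succ n j" n "\<lambda>i. \<not> ?s i"])
        show "\<not> ?s (wheel_succ n i)" if "i \<in> {1..n}" "\<not> ?s i" for i
          using f[OF that(1)] that(2) by (auto simp: rim_forward_def split: if_splits)
      qed (use calculation j wheel_succ_in in auto)
      ultimately show False by blast
    qed
    then obtain b where b: "b \<in> {1..n}" "\<not> ?f b" by blast
    \<comment> \<open>If all edges were backward, inwardness would spread, so all spokes would
      agree; no letter could then be \<open>None\<close>, and the word would be constant.\<close>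
    have "\<exists>i \<in> {1..n}. ?f i"
    proof (rule ccontr)
      assume "\<not> ?thesis"
      then have f: "\<not> ?f i" if "i \<in> {1..n}" for i using that by blast
      have step: "?s (wheel_succ n i)" if "i \<in> {1..n}" "?s i" for i
        using f[OF that(1)] that(2) by (auto simp: rim_forward_def split: if_splits)
      have "?s k" if "i \<in> {1..n}" "k \<in> {1..n}" "?s i" for i k
        using wheel_succ_closed[of i n ?s, OF that(1,3) step that(2)] .
      then have same: "?s i = ?s k" if "i \<in> {1..n}" "k \<in> {1..n}" for i k
        using that by metis
      have "w i = Some (?s 1)" if "i \<in> {1..n}" for i
      proof -
        have "?s i = ?s (wheel_succ n i)"
          by (rule same[OF that wheel_succ_in[OF that]])
        moreover have "?s i = ?s 1" by (rule same[OF that]) (use n in simp)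
        ultimately show ?thesis using f[OF that] spoke_inward_Some[OF that, of w]
          by (simp add: rim_forward_def)
      qed
      then have "w \<in> bad" using w unfolding W_def by (intro const_bad) blast
      then show False using w by (simp add: W_def)
    qed
    then obtain a where a: "a \<in> {1..n}" "?f a" by blast
    show ?thesis
      unfolding \<Phi>_def
      by (rule wheel_orientation_acyclic[OF n a b]) (simp add: rim_forward_def)
  qed
  moreover have "inj_on \<Phi> W"
  proof (rule inj_onI)
    fix w v assume wv: "w \<in> W" "v \<in> W" "\<Phi> w = \<Phi> v"
    have eq: "spoke_inward n w i = spoke_inward n v i" "rim_forward n w i = rim_forward n v i"
      if "i \<in> {1..n}" for i
      using wheel_orientation_inject[OF n wv(3)[unfolded \<Phi>_def] that] by auto
    \<comment> \<open>This decodes the word: the orientation shows where the letter is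
      \<open>None\<close>, and elsewhere the spoke direction is the letter.\<close>
    have None_iff: "u i = None \<longleftrightarrow> spoke_inward n u i = spoke_inward n u (wheel_succ n i) \<and>
      rim_forward n u i" if u: "u \<in> W" and i: "i \<in> {1..n}" for u i
    proof -
      obtain j where "j \<in> {1..n}" "u j \<noteq> None" using ex[OF u] by blast
      then show ?thesis
        using spoke_inward_None[OF i, of u j] by (auto simp: rim_forward_def)
    qed
    have "w i = v i" if i: "i \<in> {1..n}" for i
    proof (cases "w i = None")
      case True
      then show ?thesis using None_iff[OF wv(1) i] None_iff[OF wv(2) i] eq i wheel_succ_in[OF i] by simp
    next
      case False
      then have "v i \<noteq> None"
        using None_iff[OF wv(1) i] None_iff[OF wv(2) i] eq i wheel_succ_in[OF i] by simp
      then show ?thesis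
        using False eq(1)[OF i] spoke_inward_Some[of i n w] spoke_inward_Some[of i n v] i by simp
    qed
    then show "w = v" using wv(1,2) by (intro PiE_ext[of w "{1..n}" "\<lambda>_. L"]) (auto simp: W_def)
  qed
  moreover have "finite (acyclic_orientations (wheel n))"
  proof -
    have "finite {(u, v). mg_ends (wheel n) e = {u, v}}" if "e \<in> mg_edges (wheel n)" for e
    proof (rule finite_subset)
      show "{(u, v). mg_ends (wheel n) e = {u, v}} \<subseteq> {0..n} \<times> {0..n}"
        using that wheel_succ_in[of _ n] by (fastforce simp: doubleton_eq_iff)
    qed simp
    then have "finite (orientations (wheel n))" unfolding orientations_def by (intro finite_PiE) auto
    then show ?thesis by (simp add: acyclic_orientations_def)
  qed
  ultimately have "card W \<le> num_acyclic_orientations (wheel n)"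
    unfolding num_acyclic_orientations_def by (intro card_inj_on_le[of \<Phi>] image_subsetI)
  moreover have "card bad \<le> 3"
    using card_image_le[of L "\<lambda>l. restrict (\<lambda>_. l) {1..n}"] by (simp add: bad_def L_def)
  moreover have "card (\<Pi>\<^sub>E i \<in> {1..n}. L) = 3 ^ n"
    by (simp add: card_PiE L_def eval_nat_numeral)
  moreover have "card (\<Pi>\<^sub>E i \<in> {1..n}. L) - card bad \<le> card W"
    unfolding W_def by (rule diff_card_le_card_Diff) (simp add: bad_def L_def)
  ultimately show ?thesis by linarith
qed

subsection \<open>Spanning trees\<close>

lemma mg_adj_wheelE:
  assumes "(u, v) \<in> mg_adj (wheel n) A" "A \<subseteq> mg_edges (wheel n)"
  obtains (Spoke) i where "i \<in> {1..n}" "Spoke i \<in> A" "{u, v} = {0, i}"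
  | (Rim) i where "i \<in> {1..n}" "Rim i \<in> A" "{u, v} = {i, wheel_succ n i}"
proof -
  obtain e where e: "e \<in> A" "mg_ends (wheel n) e = {u, v}"
    using assms(1) by (auto simp: mg_adj_def)
  then have "e \<in> Spoke ` {1..n} \<union> Rim ` {1..n}" using assms(2) by auto
  then show thesis using e that by fastforce
qed

text \<open>The three listed edges are the edges at the rim vertex \<open>i\<close>; the chosen one
  is meant as the first edge of its path to the hub.\<close>

definition parent_choices :: "nat \<Rightarrow> (nat \<Rightarrow> wheel_edge) set" where
  "parent_choices n = (\<Pi>\<^sub>E i \<in> {1..n}. {Spoke i, Rim i, Rim (wheel_pred n i)})"

text \<open>Every rim vertex chooses an edge of \<open>A\<close> to a neighbour closer to the hub,
  where \<open>d\<close> is the distance inside \<open>A\<close>. Descent along \<open>d\<close>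
  shows that the chosen edges alone connect the wheel.\<close>

lemma spanning_tree_parent_choice:
  assumes A: "A \<in> spanning_trees (wheel n)"
  shows "\<exists>w \<in> parent_choices n. w ` {1..n} = A"
proof -
  interpret finite_multigraph "wheel n" by (rule finite_multigraph_wheel)
  let ?R = "mg_adj (wheel n) A"
  have sub: "A \<subseteq> mg_edges (wheel n)" and conn: "mg_connects (wheel n) A"
    using A by (auto simp: spanning_trees_def mg_forest_def)
  define d where "d i = (LEAST k. (i, 0) \<in> ?R ^^ k)" for i
  have parent: "\<exists>e \<in> A. e \<in> {Spoke i, Rim i, Rim (wheel_pred n i)} \<and>
      (\<exists>j. mg_ends (wheel n) e = {i, j} \<and> d j < d i)" if i: "i \<in> {1..n}" for i
  proof -
    have "(i, 0) \<in> ?R\<^sup>*" using conn i unfolding mg_connects_def by simp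
    then obtain k where "(i, 0) \<in> ?R ^^ k" by (auto simp: rtrancl_power)
    then have di: "(i, 0) \<in> ?R ^^ d i" unfolding d_def by (rule LeastI)
    then obtain m where m: "d i = Suc m" using i by (cases "d i") auto
    then obtain j where j: "(i, j) \<in> ?R" "(j, 0) \<in> ?R ^^ m"
      using relpow_Suc_D2[of i 0 m ?R] di by auto
    have "d j \<le> m" unfolding d_def using j(2) by (rule Least_le)
    then have dj: "d j < d i" using m by simp
    from j(1) sub show ?thesis
    proof (cases rule: mg_adj_wheelE)
      case (Spoke l)
      then have "l = i" using i by (auto simp: doubleton_eq_iff)
      moreover have "mg_ends (wheel n) (Spoke l) = {i, j}" using Spoke(3) by simp
      ultimately show ?thesis using Spoke(2) dj by blast
    next
      case (Rim l)
      then have "l = i \<or> l = wheel_pred n i"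
        using wheel_pred_succ[of l n] by (auto simp: doubleton_eq_iff)
      moreover have "mg_ends (wheel n) (Rim l) = {i, j}" using Rim(3) by simp
      ultimately show ?thesis using Rim(2) dj by blast
    qed
  qed
  define w where "w = restrict (\<lambda>i. SOME e. e \<in> A \<and> e \<in> {Spoke i, Rim i, Rim (wheel_pred n i)} \<and>
      (\<exists>j. mg_ends (wheel n) e = {i, j} \<and> d j < d i)) {1..n}"
  have w: "w i \<in> A \<and> w i \<in> {Spoke i, Rim i, Rim (wheel_pred n i)} \<and>
      (\<exists>j. mg_ends (wheel n) (w i) = {i, j} \<and> d j < d i)" if i: "i \<in> {1..n}" for i
    using someI_ex[OF parent[OF i, unfolded Bex_def]] i by (simp only: w_def restrict_apply if_True)
  let ?B = "w ` {1..n}"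
  have BA: "?B \<subseteq> A" by (intro image_subsetI) (rule conjunct1[OF w])
  have to_hub: "i \<le> n \<Longrightarrow> (i, 0) \<in> (mg_adj (wheel n) ?B)\<^sup>*" for i
  proof (induction "d i" arbitrary: i rule: less_induct)
    case less
    show ?case
    proof (cases "i = 0")
      case False
      then have i: "i \<in> {1..n}" using less.prems by simp
      then obtain j where j: "mg_ends (wheel n) (w i) = {i, j}" "d j < d i" using w by blast
      have "w i \<in> mg_edges (wheel n)" using w[OF i] sub by blast
      then obtain u v where "u \<le> n" "v \<le> n" "{i, j} = {u, v}"
        using ends_in_verts[of "w i"] j(1) by auto
      then have "j \<le> n" by (auto simp: doubleton_eq_iff)
      then have "(j, 0) \<in> (mg_adj (wheel n) ?B)\<^sup>*" using less.hyps j(2) by blast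
      moreover have "(i, j) \<in> mg_adj (wheel n) ?B" unfolding mg_adj_def using j(1) i by blast
      ultimately show ?thesis by (rule converse_rtrancl_into_rtrancl[rotated])
    qed simp
  qed
  have "mg_connects (wheel n) ?B"
    unfolding mg_connects_def
  proof (intro ballI)
    fix u v assume "u \<in> mg_verts (wheel n)" "v \<in> mg_verts (wheel n)"
    then show "(u, v) \<in> (mg_adj (wheel n) ?B)\<^sup>*"
      using rtrancl_trans[OF to_hub[of u] mg_adj_rtrancl_sym[OF to_hub[of v]]] by simp
  qed
  then have "mg_components (wheel n) ?B = 1"
    using mg_connects_iff_components[OF finite_verts] by simp
  \<comment> \<open>Connecting \<open>n + 1\<close> vertices takes at least \<open>n\<close> edges,
    and \<open>A\<close> has exactly \<open>n\<close>, so the chosen edges exhaust it.\<close>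
  then have "n \<le> card ?B" using mg_components_ge[of ?B] BA sub by simp
  moreover have "card A = n" using card_spanning_tree[OF _ A] by simp
  ultimately have "?B = A" using card_seteq[OF finite_sub_edges[OF sub] BA] by simp
  moreover have "w \<in> parent_choices n"
    unfolding parent_choices_def
  proof (rule PiE_I)
    show "w i = undefined" if "i \<notin> {1..n}" for i
      using that by (simp only: w_def restrict_apply if_False)
    show "w i \<in> {Spoke i, Rim i, Rim (wheel_pred n i)}" if "i \<in> {1..n}" for i
      using w[OF that] by blast
  qed
  ultimately show ?thesis by blast
qed

text \<open>Without a spoke the hub would be isolated.\<close>

lemma spanning_tree_has_Spoke:
  assumes "n \<ge> 1" and A: "A \<in> spanning_trees (wheel n)"
  shows "\<exists>i. Spoke i \<in> A"
proof (rule ccontr)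
  assume no: "\<not> ?thesis"
  have sub: "A \<subseteq> mg_edges (wheel n)" and conn: "mg_connects (wheel n) A"
    using A by (auto simp: spanning_trees_def mg_forest_def)
  have "v = 0" if "(0, v) \<in> (mg_adj (wheel n) A)\<^sup>*" for v
    using that
  proof induction
    case (step y z)
    from step.hyps(2) sub show ?case
    proof (cases rule: mg_adj_wheelE)
      case (Rim i)
      then show ?thesis using step.IH wheel_succ_in[of i n] by (auto simp: doubleton_eq_iff)
    qed (use no in blast)
  qed simp
  moreover have "(0, 1) \<in> (mg_adj (wheel n) A)\<^sup>*" using conn assms(1) by (simp add: mg_connects_def)
  ultimately show False by fastforce
qed

lemma num_spanning_trees_wheel_le:
  assumes n: "n \<ge> 2"
  shows "num_spanning_trees (wheel n) \<le> 3 ^ n - 3"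
proof -
  interpret finite_multigraph "wheel n" by (rule finite_multigraph_wheel)
  define up where "up = restrict Rim {1..n}"
  define down where "down = restrict (\<lambda>i. Rim (wheel_pred n i)) {1..n}"
  define knot where "knot = restrict (\<lambda>i. if i \<le> 2 then Rim 1 else Spoke i) {1..n}"
  let ?bad = "{up, down, knot}"
  have fin: "finite (parent_choices n)" by (simp add: parent_choices_def finite_PiE)
  have bad_sub: "?bad \<subseteq> parent_choices n"
  proof -
    have "(if i \<le> 2 then Rim 1 else Spoke i) \<in> {Spoke i, Rim i, Rim (wheel_pred n i)}"
      if "i \<in> {1..n}" for i
    proof -
      have "i = 1 \<or> i = 2 \<or> i > 2" using that by auto
      then show ?thesis by (elim disjE) (simp_all add: wheel_pred_def)
    qed
    then have "knot \<in> parent_choices n"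
      unfolding knot_def parent_choices_def restrict_PiE_iff by blast
    moreover have "up \<in> parent_choices n" "down \<in> parent_choices n"
      unfolding up_def down_def parent_choices_def restrict_PiE_iff by blast+
    ultimately show ?thesis by blast
  qed
  \<comment> \<open>The positions matter: \<open>up\<close> and \<open>knot\<close> agree at 1,
    while \<open>down\<close> and \<open>knot\<close> agree at 2.\<close>
  have "up 2 \<noteq> down 2" "up 2 \<noteq> knot 2" "down 1 \<noteq> knot 1"
    using n by (auto simp: up_def down_def knot_def wheel_pred_def)
  then have "up \<noteq> down" "up \<noteq> knot" "down \<noteq> knot" by metis+
  then have card_bad: "card ?bad = 3" by simp
  have "A \<in> (\<lambda>w. w ` {1..n}) ` (parent_choices n - ?bad)" if A: "A \<in> spanning_trees (wheel n)" for A
  proof -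
    obtain w where w: "w \<in> parent_choices n" "w ` {1..n} = A"
      using spanning_tree_parent_choice[OF A] by blast
    obtain i where "Spoke i \<in> A" using spanning_tree_has_Spoke[OF _ A] n by auto
    then have "w \<noteq> up" "w \<noteq> down" using w(2) by (auto simp: up_def down_def)
    moreover have "w \<noteq> knot"
    proof
      assume "w = knot"
      then have "w 1 = w 2" using n by (simp add: knot_def)
      moreover have "{1..n} = insert 1 {2..n}" using n by auto
      \<comment> \<open>Vertices 1 and 2 choose the same edge, which leaves at most
        \<open>n - 1\<close> edges, one fewer than a spanning tree has.\<close>
      ultimately have "A = w ` {2..n}" using w(2) n by (auto simp: image_iff)
      then have "card A \<le> card {2..n}" using card_image_le[of "{2..n}" w] by simp
      moreover have "card A = n" using card_spanning_tree[OF _ A] by simp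
      ultimately show False using n by simp
    qed
    ultimately show ?thesis using w by blast
  qed
  then have "num_spanning_trees (wheel n) \<le> card (parent_choices n - ?bad)"
    unfolding num_spanning_trees_def using fin
    by (intro surj_card_le[of _ _ "\<lambda>w. w ` {1..n}"] subsetI) simp_all
  also have "\<dots> = card (parent_choices n) - 3"
    using bad_sub card_bad by (simp add: card_Diff_subset)
  also have "\<dots> \<le> 3 ^ n - 3"
  proof -
    have "card {Spoke i, Rim i, Rim (wheel_pred n i)} \<le> 3" for i
      using card_length[of "[Spoke i, Rim i, Rim (wheel_pred n i)]"] by simp
    then have "(\<Prod>i \<in> {1..n}. card {Spoke i, Rim i, Rim (wheel_pred n i)}) \<le> (\<Prod>i \<in> {1..n}. 3)"
      by (intro prod_mono) simp
    then have "card (parent_choices n) \<le> 3 ^ n"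
      by (simp add: parent_choices_def card_PiE)
    then show ?thesis by simp
  qed
  finally show ?thesis .
qed

subsection \<open>The Tutte polynomial at (2, 0)\<close>

text \<open>This is the expansion over subsets of a nonempty product of factors
  \<open>- 1 + 1\<close>.\<close>

lemma alternating_sum_Pow:
  assumes "finite Y" "Y \<noteq> {}"
  shows "(\<Sum>T \<in> Pow Y. (- 1) ^ card T) = (0 :: int)"
proof -
  have "(\<Sum>T \<in> Pow Y. (- 1) ^ card T) = (\<Prod>y \<in> Y. - 1 + 1 :: int)"
    unfolding prod_add[OF assms(1)] by simp
  then show ?thesis using assms by (simp add: power_0_left)
qed

text \<open>The sum factorises over the fibres of \<open>f\<close>. Each fibre is nonempty, so its
  alternating sum is 0; counting the missed value flips the sign of the empty subset and changes
  this to \<open>- 2\<close>.\<close>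

lemma signed_sum_missed_values:
  assumes "finite J" "finite X" "f ` X = J"
  shows "(\<Sum>S \<in> Pow X. (- 1) ^ (card S + card (J - f ` S))) = (- 2 :: int) ^ card J"
  using assms
proof (induction J arbitrary: X rule: finite_induct)
  case empty
  then show ?case by simp
next
  case (insert j J)
  define X1 Y where "X1 = {x \<in> X. f x \<noteq> j}" and "Y = {x \<in> X. f x = j}"
  have X: "X = X1 \<union> Y" "X1 \<inter> Y = {}" by (auto simp: X1_def Y_def)
  have fin: "finite X1" "finite Y" using insert.prems(1) by (simp_all add: X1_def Y_def)
  have "Y \<noteq> {}" using insert.prems(2) by (force simp: Y_def)
  have X1: "f ` X1 = J" using insert.prems(2) insert.hyps(2) by (auto simp: X1_def)
  let ?g = "\<lambda>T. if T = {} then - 1 else 1 :: int"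
  have bij: "bij_betw (\<lambda>(S, T). S \<union> T) (Pow X1 \<times> Pow Y) (Pow X)"
    by (rule bij_betw_byWitness[where f' = "\<lambda>S. (S \<inter> X1, S \<inter> Y)"]) (use X in auto)
  have split: "(- 1) ^ (card (S \<union> T) + card (insert j J - f ` (S \<union> T))) =
      (- 1) ^ (card S + card (J - f ` S)) * ((- 1) ^ card T * ?g T)"
    if S: "S \<subseteq> X1" and T: "T \<subseteq> Y" for S T
  proof -
    have "card (S \<union> T) = card S + card T"
      using S T X fin by (intro card_Un_disjoint) (auto intro: finite_subset)
    moreover have "insert j J - f ` (S \<union> T) = (if T = {} then insert j (J - f ` S) else J - f ` S)"
    proof -
      have "j \<notin> f ` S" "f ` T = (if T = {} then {} else {j})"
        using S T by (auto simp: X1_def Y_def)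
      then show ?thesis using insert.hyps(2) by (auto simp: image_Un)
    qed
    ultimately show ?thesis using insert.hyps by (simp add: power_add)
  qed
  have "(\<Sum>T \<in> Pow Y. (- 1) ^ card T * ?g T) =
      (\<Sum>T \<in> Pow Y. (- 1) ^ card T - (if T = {} then 2 else 0))"
    by (intro sum.cong) auto
  also have "\<dots> = - 2"
    using alternating_sum_Pow[OF fin(2) \<open>Y \<noteq> {}\<close>] fin(2) by (simp add: sum_subtractf)
  finally have Y_sum: "(\<Sum>T \<in> Pow Y. (- 1) ^ card T * ?g T) = - 2" .
  have "(\<Sum>S \<in> Pow X. (- 1) ^ (card S + card (insert j J - f ` S))) =
      (\<Sum>(S, T) \<in> Pow X1 \<times> Pow Y. (- 1) ^ (card (S \<union> T) + card (insert j J - f ` (S \<union> T))))"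
    by (subst sum.reindex_bij_betw[OF bij, symmetric]) (simp add: case_prod_unfold)
  also have "\<dots> = (\<Sum>(S, T) \<in> Pow X1 \<times> Pow Y.
      (- 1) ^ (card S + card (J - f ` S)) * ((- 1) ^ card T * ?g T))"
    by (intro sum.cong) (auto simp only: split Pow_iff mem_Times_iff prod.case fst_conv snd_conv)
  also have "\<dots> = (\<Sum>S \<in> Pow X1. (- 1) ^ (card S + card (J - f ` S))) *
      (\<Sum>T \<in> Pow Y. (- 1) ^ card T * ?g T)"
    by (simp only: sum.cartesian_product[symmetric] sum_product)
  also have "\<dots> = (- 2) ^ card J * - 2"
    by (simp only: insert.IH[OF fin(1) X1] Y_sum)
  finally show ?case using insert.hyps by simp
qed

section \<open>Components of the spanning subgraphs of the wheel\<close>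

text \<open>The induction is on the length of an arbitrary walk into \<open>J\<close> instead of the
  shortest one; it ends early whenever the current vertex lies in \<open>J\<close>.\<close>

lemma next_in_rtrancl:
  assumes "J \<subseteq> {1..n}" "J \<noteq> {}" "i \<in> {1..n}"
    and step: "\<And>j. j \<in> {1..n} - J \<Longrightarrow> (j, wheel_succ n j) \<in> R"
  shows "(i, next_in n J i) \<in> R\<^sup>*"
proof -
  have "(i, next_in n J i) \<in> R\<^sup>*" if "(wheel_succ n ^^ k) i \<in> J" "i \<in> {1..n}" for k i
    using that
  proof (induction k arbitrary: i)
    case 0
    then show ?case by (simp add: next_in_self)
  next
    case (Suc k)
    show ?case
    proof (cases "i \<in> J")
      case True
      then show ?thesis by (simp add: next_in_self)
    next
      case False
      have "(wheel_succ n ^^ k) (wheel_succ n i) \<in> J"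
        using Suc.prems(1) by (simp add: funpow_swap1)
      then have "(wheel_succ n i, next_in n J (wheel_succ n i)) \<in> R\<^sup>*"
        using Suc.IH wheel_succ_in Suc.prems(2) by blast
      then show ?thesis
        using step[of i] next_in_succ[OF assms(1,2) Suc.prems(2) False] False Suc.prems(2)
        by (simp add: converse_rtrancl_into_rtrancl)
    qed
  qed
  moreover obtain j where "j \<in> J" using assms(2) by blast
  then obtain k where "(wheel_succ n ^^ k) i \<in> J"
    using wheel_succ_reaches[OF assms(3)] assms(1) by blast
  ultimately show ?thesis using assms(3) by blast
qed

text \<open>\<open>C\<close> collects the missing rim edges because these are the cuts between the
  arcs, whereas \<open>S\<close> collects the spokes that are present.\<close>

definition wheel_edge_set :: "nat \<Rightarrow> nat set \<Rightarrow> nat set \<Rightarrow> wheel_edge set" where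
  "wheel_edge_set n C S = Rim ` ({1..n} - C) \<union> Spoke ` S"

text \<open>
  Removing the rim edges at \<open>C\<close> leaves one arc of the rim ending at each element of \<open>C\<close>;
  if \<open>C\<close> is empty, the whole rim serves as an arc ending at 1.
\<close>

definition arc_ends :: "nat set \<Rightarrow> nat set" where
  "arc_ends C = (if C = {} then {1} else C)"

lemma bij_wheel_edge_set:
  "bij_betw (\<lambda>(C, S). wheel_edge_set n C S) (Pow {1..n} \<times> Pow {1..n}) (Pow (mg_edges (wheel n)))"
  by (rule bij_betw_byWitness[where
        f' = "\<lambda>A. ({i \<in> {1..n}. Rim i \<notin> A}, {i. Spoke i \<in> A})"])
    (auto simp: wheel_edge_set_def)

lemma card_wheel_edge_set:
  assumes "C \<subseteq> {1..n}" "S \<subseteq> {1..n}"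
  shows "card (wheel_edge_set n C S) = n - card C + card S"
proof -
  have fin: "finite C" "finite S" using assms finite_subset by blast+
  have "card (wheel_edge_set n C S) = card (Rim ` ({1..n} - C)) + card (Spoke ` S)"
    unfolding wheel_edge_set_def using fin by (intro card_Un_disjoint) auto
  also have "\<dots> = n - card C + card S"
    using assms fin by (simp add: card_image inj_on_def card_Diff_subset)
  finally show ?thesis .
qed

text \<open>Every arc is connected. The arcs that contain a vertex of \<open>S\<close> join the
  component of the hub, which accounts for \<open>Suc\<close>; each other arc is a component of its
  own.\<close>

lemma mg_components_wheel:
  assumes n: "n \<ge> 1" and C: "C \<subseteq> {1..n}" and S: "S \<subseteq> {1..n}"
  shows "mg_components (wheel n) (wheel_edge_set n C S) =
    Suc (card (arc_ends C - next_in n (arc_ends C) ` S))"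
proof -
  let ?A = "wheel_edge_set n C S" and ?J = "arc_ends C"
  let ?next = "next_in n ?J" and ?R = "mg_adj (wheel n) ?A"
  have J: "?J \<subseteq> {1..n}" "?J \<noteq> {}" "C \<subseteq> ?J" using n C by (auto simp: arc_ends_def)
  \<comment> \<open>The component of the hub is labelled 0, which is no arc end, and every other arc
    is labelled by its end.\<close>
  define l where "l u = (if u = 0 \<or> ?next u \<in> ?next ` S then 0 else ?next u)" for u
  have to_next: "(u, ?next u) \<in> ?R\<^sup>*" if "u \<in> {1..n}" for u
  proof (rule next_in_rtrancl[OF J(1,2) that])
    fix j assume "j \<in> {1..n} - ?J"
    then have "Rim j \<in> ?A" using J(3) by (auto simp: wheel_edge_set_def)
    then show "(j, wheel_succ n j) \<in> ?R" by (force simp: mg_adj_def)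
  qed
  have "mg_components (wheel n) ?A = card (l ` mg_verts (wheel n))"
  proof (rule mg_components_label)
    fix u assume "u \<in> mg_verts (wheel n)"
    then consider "u = 0" | "u \<in> {1..n}" "?next u \<in> ?next ` S" | "u \<in> {1..n}" "?next u \<notin> ?next ` S"
      by fastforce
    then show "(u, l u) \<in> ?R\<^sup>*"
    proof cases
      case 2
      then obtain i where i: "i \<in> S" "?next u = ?next i" by blast
      then have "(i, ?next u) \<in> ?R\<^sup>*" using to_next[of i] S by auto
      then have "(u, i) \<in> ?R\<^sup>*" using to_next[OF 2(1)] mg_adj_rtrancl_sym rtrancl_trans by metis
      moreover have "(i, 0) \<in> ?R"
        using i(1) by (force simp: mg_adj_def wheel_edge_set_def)
      ultimately show ?thesis using 2 by (simp add: l_def rtrancl_into_rtrancl)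
    next
      case 3
      then show ?thesis using to_next by (simp add: l_def)
    qed (simp add: l_def)
  next
    fix u v assume "(u, v) \<in> ?R"
    then obtain e where e: "e \<in> ?A" "mg_ends (wheel n) e = {u, v}" by (auto simp: mg_adj_def)
    show "l u = l v"
    proof (cases e)
      case (Spoke i)
      then have "i \<in> S" "{u, v} = {0, i}" using e by (auto simp: wheel_edge_set_def)
      then show ?thesis by (auto simp: l_def doubleton_eq_iff)
    next
      case (Rim i)
      then have i: "i \<in> {1..n}" "i \<notin> C" "{u, v} = {i, wheel_succ n i}"
        using e by (auto simp: wheel_edge_set_def)
      have "?next i = ?next (wheel_succ n i)"
      \<comment> \<open>An arc end outside \<open>C\<close> occurs only for empty \<open>C\<close>,
        when the edge at 1 closes the single arc to the full rim.\<close>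
      proof (cases "i \<in> ?J")
        case True
        then have "?J = {1}" using i(2) by (simp add: arc_ends_def split: if_splits)
        then show ?thesis
          using next_in_mem[OF J(1,2) i(1)] next_in_mem[OF J(1,2) wheel_succ_in[OF i(1)]] by simp
      next
        case False
        then show ?thesis using next_in_succ[OF J(1,2) i(1)] by simp
      qed
      moreover have "i \<noteq> 0" "wheel_succ n i \<noteq> 0" using i(1) wheel_succ_in[OF i(1)] by auto
      ultimately have "l i = l (wheel_succ n i)" by (simp add: l_def)
      then show ?thesis using i(3) by (auto simp: doubleton_eq_iff)
    qed
  qed
  also have "l ` mg_verts (wheel n) = insert 0 (?J - ?next ` S)"
  proof (intro equalityI subsetI)
    fix x assume "x \<in> l ` mg_verts (wheel n)"
    then show "x \<in> insert 0 (?J - ?next ` S)"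
      using next_in_mem[OF J(1,2)] by (auto simp: l_def split: if_splits)
  next
    fix x assume x: "x \<in> insert 0 (?J - ?next ` S)"
    show "x \<in> l ` mg_verts (wheel n)"
    proof (cases "x = 0")
      case True
      then show ?thesis by (intro image_eqI[of _ _ 0]) (simp_all add: l_def)
    next
      case False
      then have "l x = x" "x \<in> {1..n}" using x J(1) by (auto simp: l_def next_in_self)
      then show ?thesis by (intro image_eqI[of _ _ x]) simp_all
    qed
  qed
  also have "card \<dots> = Suc (card (?J - ?next ` S))"
  proof -
    have "0 \<notin> ?J" "finite ?J" using J(1) finite_subset by auto
    then show ?thesis by simp
  qed
  finally show ?thesis .
qed

section \<open>Evaluation at (2, 0) and the final comparison\<close>

lemma tutte_wheel_2_0:
  assumes n: "n \<ge> 1"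
  shows "(tutte (cycle_matroid (wheel n)) 2 0 :: int) = 3 ^ n - 3"
proof -
  interpret finite_multigraph "wheel n" by (rule finite_multigraph_wheel)
  let ?M = "cycle_matroid (wheel n)" and ?E = "mg_edges (wheel n)" and ?N = "{1..n}"
  let ?dead = "\<lambda>C S. card (arc_ends C - next_in n (arc_ends C) ` S)"
  have ground: "mat_ground ?M = ?E" by (simp add: cycle_matroid_def)
  have summand: "(- 1 :: int) ^ (card (wheel_edge_set n C S) - mat_rank ?M (wheel_edge_set n C S)) =
      (- 1) ^ card C * (- 1) ^ (card S + ?dead C S)" if C: "C \<subseteq> ?N" and S: "S \<subseteq> ?N" for C S
  proof -
    have A: "wheel_edge_set n C S \<subseteq> ?E" using C S by (auto simp: wheel_edge_set_def)
    have rank: "mat_rank ?M (wheel_edge_set n C S) = n - ?dead C S"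
      using cycle_matroid_rank[OF A] mg_components_wheel[OF n C S] by simp
    have le: "n - ?dead C S \<le> n - card C + card S"
      using cycle_matroid_rank_le_card[OF A] rank card_wheel_edge_set[OF C S] by simp
    have "arc_ends C \<subseteq> ?N" using C n by (auto simp: arc_ends_def)
    then have "arc_ends C - next_in n (arc_ends C) ` S \<subseteq> ?N" by blast
    then have "?dead C S \<le> card ?N" by (intro card_mono) simp_all
    then have dead: "?dead C S \<le> n" by simp
    have "card C \<le> card ?N" using C by (intro card_mono) simp_all
    then have "card C \<le> n" by simp
    have parity: "even (n - c + s - (n - d)) \<longleftrightarrow> even (c + (s + d))"
      if "n - d \<le> n - c + s" "d \<le> n" "c \<le> n" for c s d :: nat
    proof -
      \<comment> \<open>Adding \<open>2 * (n - d) + d\<close> to both sides of the parity question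
        removes the truncated subtraction; the three assumptions guarantee that nothing was cut
        off.\<close>
      have "n - c + s - (n - d) + 2 * (n - d) + d = 2 * (n - c) + (c + s)" using that by simp
      then have "even (n - c + s - (n - d) + 2 * (n - d) + d) \<longleftrightarrow> even (2 * (n - c) + (c + s))"
        by (rule arg_cong)
      then show ?thesis by (auto simp del: even_diff_nat)
    qed
    show ?thesis
      unfolding rank card_wheel_edge_set[OF C S] power_add[symmetric]
      by (simp only: minus_one_power_iff parity[OF le dead \<open>card C \<le> n\<close>])
  qed
  have inner: "(\<Sum>S \<in> Pow ?N. (- 1 :: int) ^ card C * (- 1) ^ (card S + ?dead C S)) =
      2 ^ card C - (if C = {} then 3 else 0)" if C: "C \<subseteq> ?N" for C
  proof -
    have J: "arc_ends C \<subseteq> ?N" "arc_ends C \<noteq> {}" using C n by (auto simp: arc_ends_def)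
    have surj: "next_in n (arc_ends C) ` ?N = arc_ends C"
    proof (intro equalityI subsetI)
      show "x \<in> arc_ends C" if "x \<in> next_in n (arc_ends C) ` ?N" for x
        using that next_in_mem[OF J] by blast
      show "x \<in> next_in n (arc_ends C) ` ?N" if "x \<in> arc_ends C" for x
        using that J(1) by (intro image_eqI[of _ _ x]) (auto simp: next_in_self)
    qed
    have "finite (arc_ends C)" using J(1) finite_subset by blast
    from signed_sum_missed_values[OF this _ surj]
    have "(\<Sum>S \<in> Pow ?N. (- 1 :: int) ^ card C * (- 1) ^ (card S + ?dead C S)) =
        (- 1) ^ card C * (- 2) ^ card (arc_ends C)"
      by (simp only: sum_distrib_left[symmetric] finite_atLeastAtMost)
    \<comment> \<open>For nonempty \<open>C\<close> the two signs cancel. Empty \<open>C\<close> has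
      one arc end, so the value is \<open>- 2\<close>, written as \<open>2 ^ 0 - 3\<close> to keep
      one formula for all \<open>C\<close>.\<close>
    also have "\<dots> = 2 ^ card C - (if C = {} then 3 else 0)"
      by (simp add: arc_ends_def flip: power_mult_distrib)
    finally show ?thesis .
  qed
  have "(tutte ?M 2 0 :: int) = (\<Sum>A \<in> Pow ?E. (- 1) ^ (card A - mat_rank ?M A))"
    unfolding tutte_def ground by simp
  also have "\<dots> = (\<Sum>(C, S) \<in> Pow ?N \<times> Pow ?N.
      (- 1) ^ (card (wheel_edge_set n C S) - mat_rank ?M (wheel_edge_set n C S)))"
    by (subst sum.reindex_bij_betw[OF bij_wheel_edge_set, symmetric]) (simp add: case_prod_unfold)
  also have "\<dots> = (\<Sum>C \<in> Pow ?N. \<Sum>S \<in> Pow ?N. (- 1) ^ card C * (- 1) ^ (card S + ?dead C S))"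
    unfolding sum.cartesian_product[symmetric] by (intro sum.cong refl summand) blast+
  also have "\<dots> = (\<Sum>C \<in> Pow ?N. 2 ^ card C - (if C = {} then 3 else 0))"
    by (intro sum.cong refl inner) blast
  also have "\<dots> = (\<Sum>C \<in> Pow ?N. 2 ^ card C) - 3"
    by (simp add: sum_subtractf)
  \<comment> \<open>This is the binomial expansion over subsets of a product of \<open>n\<close>
    factors \<open>2 + 1\<close>.\<close>
  also have "(\<Sum>C \<in> Pow ?N. 2 ^ card C) = (\<Prod>i \<in> ?N. 2 + 1 :: int)"
    unfolding prod_add[OF finite_atLeastAtMost] by simp
  finally show ?thesis by simp
qed

lemma mg_connects_wheel: "mg_connects (wheel n) (mg_edges (wheel n))"
proof -
  let ?R = "mg_adj (wheel n) (mg_edges (wheel n))"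
  have to_hub: "(u, 0) \<in> ?R\<^sup>*" if "u \<le> n" for u
  proof (cases "u = 0")
    case False
    then have "(u, 0) \<in> ?R" using that by (force simp: mg_adj_def)
    then show ?thesis by blast
  qed simp
  show ?thesis
    unfolding mg_connects_def
  proof (intro ballI)
    fix u v assume "u \<in> mg_verts (wheel n)" "v \<in> mg_verts (wheel n)"
    then show "(u, v) \<in> ?R\<^sup>*"
      using rtrancl_trans[OF to_hub[of u] mg_adj_rtrancl_sym[OF to_hub[of v]]] by simp
  qed
qed

theorem theorem5p1:
  fixes n :: nat
  assumes "n \<ge> 2"
  shows "num_acyclic_orientations (wheel n) \<ge> num_spanning_trees (wheel n) \<and>
    max (tutte (cycle_matroid (wheel n)) 2 0) (tutte (cycle_matroid (wheel n)) 0 2)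
      \<ge> (tutte (cycle_matroid (wheel n)) 1 1 :: int)"
proof
  show "num_acyclic_orientations (wheel n) \<ge> num_spanning_trees (wheel n)"
    using num_spanning_trees_wheel_le[OF assms] num_acyclic_orientations_wheel_ge[OF assms] by simp
  have "(tutte (cycle_matroid (wheel n)) 1 1 :: int) \<le> int (num_spanning_trees (wheel n))"
    by (rule finite_multigraph.tutte_1_1_le_spanning_trees
        [OF finite_multigraph_wheel _ mg_connects_wheel]) simp
  also have "\<dots> \<le> int (3 ^ n - 3)"
    using num_spanning_trees_wheel_le[OF assms] by (rule of_nat_mono)
  also have "int (3 ^ n - 3) = 3 ^ n - 3"
    \<comment> \<open>The bound \<open>3 \<le> 3 ^ n\<close> lets the subtraction of natural numbers
      pass to the integers.\<close>
    using assms power_increasing[of 1 n "3 :: nat"] by (simp add: of_nat_diff)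
  also have "\<dots> = tutte (cycle_matroid (wheel n)) 2 0"
    using tutte_wheel_2_0[of n] assms by simp
  finally show "max (tutte (cycle_matroid (wheel n)) 2 0) (tutte (cycle_matroid (wheel n)) 0 2)
      \<ge> (tutte (cycle_matroid (wheel n)) 1 1 :: int)" by simp
qed

end
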